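(* Let $\mathcal H=(M,n,\mathcal R)$ be a bounded-rate multi-mode system (BMS) and let $S\subseteq\mathbb R^n$ be a bounded convex polytope (the safety set). Then the schedulability game on $\mathcal H$ with safety set $S$ is positionally determined: for every starting state $x_0\in S$, exactly one of the two players (scheduler or environment) has a winning strategy, and that player has a positional winning strategy.
   Context: A multi-mode system is a tuple $\mathcal H=(M,n,\mathcal R)$ where $M$ is a finite nonempty set of modes, $n\ge 1$ is the number of real-valued variables, and $\mathcal R:M\to 2^{\mathbb R^n}$ assigns to each mode a nonempty set of rate vectors. It is a bounded-rate multi-mode system (BMS) if every $\mathcal R(m)$ is a (bounded) convex polytope. The schedulability game from a starting state $x_0\in\mathbb R^n$ proceeds in infinitely many rounds: in round $i\ge 1$ the scheduler chooses a timed move $(m_i,t_i)\in M\times\mathbb R_{>0}$, then the environment chooses a rate $r_i\in\mathcal R(m_i)$, and the state becomes $x_i=x_{i-1}+t_i r_i$. A scheduler strategy maps each finite history $\langle x_0,(m_1,t_1),r_1,x_1,\dots,(m_k,t_k),r_k,x_k\rangle$ to a timed move; an environment strategy maps a finite history together with the scheduler's current timed move $(m,t)$ to a rate in $\mathcal R(m)$. A strategy is positional if its choice depends only on the last state of the history (and, for the environment, on the current timed move). For a safety set $S$, an infinite run is $S$-safe if $x_i\in S$ and $x_i+t r_{i+1}\in S$ for all $i\ge 0$ and all $t\in[0,t_{i+1}]$; it is non-Zeno if $\sum_{i\ge1}t_i=\infty$. A scheduler strategy is winning from $x_0$ if against every environment strategy the resulting run is $S$-safe and non-Zeno; an environment strategy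 is winning from $x_0$ if against every scheduler strategy the resulting run is not both $S$-safe and non-Zeno. *)

theory Defs
  imports "HOL-Analysis.Analysis"
begin

definition is_BMS :: "'m set \<Rightarrow> ('m \<Rightarrow> (real^'n::finite) set) \<Rightarrow> bool" where
  "is_BMS M R \<longleftrightarrow> finite M \<and> M \<noteq> {} \<and> (\<forall>m\<in>M. R m \<noteq> {} \<and> polytope (R m))"

text \<open>A finite history  x0, (m1,t1), r1, x1, ..., (mk,tk), rk, xk  is represented as
  the start state x0 together with the list of triples ((m_i,t_i), r_i, x_i).\<close>

type_synonym ('m,'n) hist = "(real^'n::finite) \<times> ((('m \<times> real) \<times> (real^'n) \<times> (real^'n)) list)"

definition hist_last :: "('m,'n::finite) hist \<Rightarrow> real^'n" where
  "hist_last h = (if snd h = [] then fst h else snd (snd (last (snd h))))"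

definition sched_strategy :: "'m set \<Rightarrow> (('m,'n::finite) hist \<Rightarrow> 'm \<times> real) \<Rightarrow> bool" where
  "sched_strategy M \<sigma> \<longleftrightarrow> (\<forall>h. fst (\<sigma> h) \<in> M \<and> snd (\<sigma> h) > 0)"

definition env_strategy ::
  "'m set \<Rightarrow> ('m \<Rightarrow> (real^'n::finite) set) \<Rightarrow> (('m,'n::finite) hist \<Rightarrow> 'm \<times> real \<Rightarrow> real^'n) \<Rightarrow> bool" where
  "env_strategy M R \<pi> \<longleftrightarrow> (\<forall>h m t. m \<in> M \<longrightarrow> t > 0 \<longrightarrow> \<pi> h (m, t) \<in> R m)"

definition sched_positional :: "(('m,'n::finite) hist \<Rightarrow> 'm \<times> real) \<Rightarrow> bool" where
  "sched_positional \<sigma> \<longleftrightarrow> (\<forall>h h'. hist_last h = hist_last h' \<longrightarrow> \<sigma> h = \<sigma> h')"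

definition env_positional :: "(('m,'n::finite) hist \<Rightarrow> 'm \<times> real \<Rightarrow> real^'n) \<Rightarrow> bool" where
  "env_positional \<pi> \<longleftrightarrow> (\<forall>h h' mv. hist_last h = hist_last h' \<longrightarrow> \<pi> h mv = \<pi> h' mv)"

primrec play ::
  "(('m,'n::finite) hist \<Rightarrow> 'm \<times> real) \<Rightarrow> (('m,'n::finite) hist \<Rightarrow> 'm \<times> real \<Rightarrow> real^'n) \<Rightarrow> real^'n \<Rightarrow> nat \<Rightarrow> ('m,'n::finite) hist" where
  "play \<sigma> \<pi> x0 0 = (x0, [])"
| "play \<sigma> \<pi> x0 (Suc k) =
     (let h = play \<sigma> \<pi> x0 k; mv = \<sigma> h; r = \<pi> h mv
      in (fst h, snd h @ [(mv, r, hist_last h + snd mv *\<^sub>R r)]))"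

text \<open>The run is S-safe and non-Zeno.  Round i+1 is played from history  play i,
  whose last state is x_i; the timed move is (m_{i+1}, t_{i+1}) and the rate r_{i+1}.\<close>

definition safe_nonzeno ::
  "(real^'n::finite) set \<Rightarrow> (('m,'n::finite) hist \<Rightarrow> 'm \<times> real) \<Rightarrow> (('m,'n::finite) hist \<Rightarrow> 'm \<times> real \<Rightarrow> real^'n)
   \<Rightarrow> real^'n \<Rightarrow> bool" where
  "safe_nonzeno S \<sigma> \<pi> x0 \<longleftrightarrow>
     (\<forall>i. let h = play \<sigma> \<pi> x0 i; mv = \<sigma> h; r = \<pi> h mv
          in hist_last h \<in> S \<and> (\<forall>\<tau>\<in>{0..snd mv}. hist_last h + \<tau> *\<^sub>R r \<in> S))
   \<and> filterlim (\<lambda>k. \<Sum>i<k. snd (\<sigma> (play \<sigma> \<pi> x0 i))) at_top sequentially"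

definition sched_wins ::
  "'m set \<Rightarrow> ('m \<Rightarrow> (real^'n::finite) set) \<Rightarrow> (real^'n) set \<Rightarrow> real^'n \<Rightarrow> (('m,'n::finite) hist \<Rightarrow> 'm \<times> real) \<Rightarrow> bool" where
  "sched_wins M R S x0 \<sigma> \<longleftrightarrow> sched_strategy M \<sigma> \<and>
     (\<forall>\<pi>. env_strategy M R \<pi> \<longrightarrow> safe_nonzeno S \<sigma> \<pi> x0)"

definition env_wins ::
  "'m set \<Rightarrow> ('m \<Rightarrow> (real^'n::finite) set) \<Rightarrow> (real^'n) set \<Rightarrow> real^'n
   \<Rightarrow> (('m,'n::finite) hist \<Rightarrow> 'm \<times> real \<Rightarrow> real^'n) \<Rightarrow> bool" where
  "env_wins M R S x0 \<pi> \<longleftrightarrow> env_strategy M R \<pi> \<and>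
     (\<forall>\<sigma>. sched_strategy M \<sigma> \<longrightarrow> \<not> safe_nonzeno S \<sigma> \<pi> x0)"

end

theory Submission
  imports Defs
begin

text \<open>Write \<open>S\<close> as a finite intersection of half-spaces and let \<open>J(x)\<close> be the set of constraints active
  at \<open>x\<close>. If some \<open>J \<subseteq> J(x0)\<close> and some direction \<open>v\<close> admit one rate per mode that either violates a
  constraint in \<open>J\<close> at once or keeps all of \<open>J\<close> active and strictly decreases \<open>v\<close>, the environment
  wins by always playing these rates, since \<open>v\<close> is bounded on \<open>S\<close>. Otherwise, for every
  \<open>J \<subseteq> J(x0)\<close> and every \<open>v\<close> some mode has only rates that respect \<open>J\<close> and do not decrease \<open>v\<close>
  unless they deactivate a constraint. At \<open>x\<close> the scheduler takes such a mode for \<open>J = J(x)\<close> and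
  \<open>v = \<nabla>w(x)\<close>, where \<open>w\<close> is the product of the slacks of the inactive constraints, and plays it for
  time \<open>\<delta> w(x)\<close>. Active sets can only shrink, so they are eventually constant; from then on
  \<open>w(x\<^sub>k\<^sub>+\<^sub>1) \<ge> w(x\<^sub>k) - w(x\<^sub>k)\<^sup>2/2\<close>, hence \<open>w(x\<^sub>k)\<close> decays no faster than \<open>1/k\<close> and total time diverges.\<close>

section \<open>Half-space description with slacks scaled into the unit interval\<close>

text \<open>Dividing each constraint by a bound on its slack over \<open>S\<close> leaves its
  half-space unchanged. With all slacks at most 1, a product of slacks is at most each of its
  factors, which \<open>barrier_exists\<close> exploits.\<close>

lemma polytope_normalized_halfspaces:
  fixes S :: "'a::euclidean_space set"
  assumes "polytope S"
  obtains I :: "'a set set" and a b where "finite I" "S = {x. \<forall>i\<in>I. a i \<bullet> x \<le> b i}"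
    "\<And>x i. x \<in> S \<Longrightarrow> i \<in> I \<Longrightarrow> b i - a i \<bullet> x \<le> (1::real)"
proof -
  obtain I where I: "finite I" "S = \<Inter>I"
    and "\<forall>h\<in>I. \<exists>a b. a \<noteq> 0 \<and> h = {x. a \<bullet> x \<le> b}"
    using polytope_imp_polyhedron[OF assms] unfolding polyhedron_def by blast
  then obtain a b where h: "\<And>h. h \<in> I \<Longrightarrow> h = {x. a h \<bullet> x \<le> b h}" by metis
  obtain B where B: "B > 0" "\<And>x. x \<in> S \<Longrightarrow> norm x \<le> B"
    using polytope_imp_bounded[OF assms] unfolding bounded_pos by blast
  \<comment> \<open>The summand 1 keeps the divisor positive even when \<open>a i\<close> and
    \<open>b i\<close> vanish.\<close>
  define K where "K = (\<lambda>i. 1 + \<bar>b i\<bar> + norm (a i) * B)"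
  have K: "K i > 0" for i unfolding K_def using B by (simp add: add_pos_nonneg)
  show thesis
  proof (rule that[of I "\<lambda>i. a i /\<^sub>R K i" "\<lambda>i. b i / K i"])
    have "(a i /\<^sub>R K i) \<bullet> x \<le> b i / K i \<longleftrightarrow> a i \<bullet> x \<le> b i" for i x
      using K[of i] by (simp add: field_simps)
    moreover have "S = {x. \<forall>i\<in>I. a i \<bullet> x \<le> b i}" using I(2) h by blast
    ultimately show "S = {x. \<forall>i\<in>I. (a i /\<^sub>R K i) \<bullet> x \<le> b i / K i}" by simp
  next
    fix x i assume x: "x \<in> S" "i \<in> I"
    have "\<bar>a i \<bullet> x\<bar> \<le> norm (a i) * B"
      using Cauchy_Schwarz_ineq2[of "a i" x] B(2)[OF x(1)]
      by (meson mult_left_mono norm_ge_zero order_trans)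
    then have "b i - a i \<bullet> x \<le> K i" unfolding K_def by linarith
    then show "b i / K i - (a i /\<^sub>R K i) \<bullet> x \<le> 1" using K[of i] by (simp add: field_simps)
  qed (fact I)
qed

section \<open>Second-order estimates for products of slacks\<close>

text \<open>\<open>G\<close> plays the role of the gradient of \<open>f\<close>; one constant bounds \<open>f\<close>, its Lipschitz constant and
  its second-order error, so that the class is closed under products.\<close>

definition quadratic_approx ::
  "'a::real_inner set \<Rightarrow> ('a \<Rightarrow> real) \<Rightarrow> ('a \<Rightarrow> 'a) \<Rightarrow> real \<Rightarrow> bool" where
  "quadratic_approx S f G C \<longleftrightarrow> (\<forall>x\<in>S. \<bar>f x\<bar> \<le> C) \<and>
     (\<forall>x\<in>S. \<forall>y\<in>S. \<bar>f y - f x\<bar> \<le> C * norm (y - x) \<and>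
        \<bar>f y - f x - G x \<bullet> (y - x)\<bar> \<le> C * (norm (y - x))\<^sup>2)"

text \<open>Product rule with remainder: the error splits into \<open>f x\<close> times the error of
  \<open>g\<close>, \<open>g x\<close> times the error of \<open>f\<close>, and the product of the
  two increments. Each is at most \<open>C * D\<close> times the squared distance, whence the factor
  3.\<close>

lemma quadratic_approx_mult:
  assumes f: "quadratic_approx S f F C" and g: "quadratic_approx S g G D"
    and "C \<ge> 0" "D \<ge> 0"
  shows "quadratic_approx S (\<lambda>x. f x * g x) (\<lambda>x. f x *\<^sub>R G x + g x *\<^sub>R F x) (3 * C * D)"
  unfolding quadratic_approx_def
proof (intro conjI ballI)
  fix x assume "x \<in> S"
  then have "\<bar>f x\<bar> * \<bar>g x\<bar> \<le> C * D"
    using f g assms(3) unfolding quadratic_approx_def by (intro mult_mono) auto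
  moreover have "C * D \<ge> 0" using assms by simp
  ultimately show "\<bar>f x * g x\<bar> \<le> 3 * C * D" by (simp add: abs_mult)
next
  fix x y assume xy: "x \<in> S" "y \<in> S"
  let ?n = "norm (y - x)"
  have b: "\<bar>f x\<bar> \<le> C" "\<bar>g x\<bar> \<le> D" "\<bar>g y\<bar> \<le> D"
    and l: "\<bar>f y - f x\<bar> \<le> C * ?n" "\<bar>g y - g x\<bar> \<le> D * ?n"
    and q: "\<bar>f y - f x - F x \<bullet> (y - x)\<bar> \<le> C * ?n\<^sup>2" "\<bar>g y - g x - G x \<bullet> (y - x)\<bar> \<le> D * ?n\<^sup>2"
    using f g xy unfolding quadratic_approx_def by auto
  have "f y * g y - f x * g x = f x * (g y - g x) + (f y - f x) * g y"
    by (simp add: algebra_simps)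
  moreover have "\<bar>f x * (g y - g x)\<bar> \<le> C * (D * ?n)"
    unfolding abs_mult using b l assms by (intro mult_mono) auto
  moreover have "\<bar>(f y - f x) * g y\<bar> \<le> (C * ?n) * D"
    unfolding abs_mult using b l assms by (intro mult_mono) auto
  moreover have "0 \<le> C * (D * ?n)" using assms by simp
  ultimately show "\<bar>f y * g y - f x * g x\<bar> \<le> 3 * C * D * ?n" by (simp add: algebra_simps)
  have "f y * g y - f x * g x - (f x *\<^sub>R G x + g x *\<^sub>R F x) \<bullet> (y - x) =
      f x * (g y - g x - G x \<bullet> (y - x)) + g x * (f y - f x - F x \<bullet> (y - x)) + (f y - f x) * (g y - g x)"
    by (simp add: algebra_simps inner_add_left)
  moreover have "\<bar>f x * (g y - g x - G x \<bullet> (y - x))\<bar> \<le> C * (D * ?n\<^sup>2)"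
    unfolding abs_mult using b q assms by (intro mult_mono) auto
  moreover have "\<bar>g x * (f y - f x - F x \<bullet> (y - x))\<bar> \<le> D * (C * ?n\<^sup>2)"
    unfolding abs_mult using b q assms by (intro mult_mono) auto
  moreover have "\<bar>(f y - f x) * (g y - g x)\<bar> \<le> (C * ?n) * (D * ?n)"
    unfolding abs_mult using l assms by (intro mult_mono) auto
  ultimately show "\<bar>f y * g y - f x * g x - (f x *\<^sub>R G x + g x *\<^sub>R F x) \<bullet> (y - x)\<bar> \<le> 3 * C * D * ?n\<^sup>2"
    by (simp add: algebra_simps power2_eq_square)
qed

lemma quadratic_approx_prod_affine:
  fixes S :: "'a::euclidean_space set"
  assumes "finite A" "bounded S"
  shows "\<exists>G C. C \<ge> 0 \<and> quadratic_approx S (\<lambda>x. \<Prod>i\<in>A. b i - a i \<bullet> x) G C"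
  using assms(1)
proof (induction A rule: finite_induct)
  case empty
  have "quadratic_approx S (\<lambda>x. 1) (\<lambda>x. 0) 1" by (simp add: quadratic_approx_def)
  then show ?case by (intro exI[of _ "\<lambda>x. 0"] exI[of _ 1]) simp
next
  case (insert j A)
  then obtain G C where G: "C \<ge> 0" "quadratic_approx S (\<lambda>x. \<Prod>i\<in>A. b i - a i \<bullet> x) G C"
    by blast
  obtain B where B: "B > 0" "\<And>x. x \<in> S \<Longrightarrow> norm x \<le> B"
    using assms(2) unfolding bounded_pos by blast
  define D where "D = norm (a j) + \<bar>b j\<bar> + norm (a j) * B"
  have D: "D \<ge> 0" "norm (a j) \<le> D" unfolding D_def using B by auto
  have "quadratic_approx S (\<lambda>x. b j - a j \<bullet> x) (\<lambda>x. - a j) D"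
    unfolding quadratic_approx_def
  proof (intro conjI ballI)
    fix x assume x: "x \<in> S"
    have "\<bar>a j \<bullet> x\<bar> \<le> norm (a j) * B"
      using Cauchy_Schwarz_ineq2[of "a j" x] B(2)[OF x]
      by (meson mult_left_mono norm_ge_zero order_trans)
    then show "\<bar>b j - a j \<bullet> x\<bar> \<le> D" unfolding D_def using norm_ge_zero[of "a j"] by linarith
  next
    fix x y
    have "\<bar>b j - a j \<bullet> y - (b j - a j \<bullet> x)\<bar> = \<bar>a j \<bullet> (y - x)\<bar>"
      by (simp add: inner_diff_right)
    also have "\<dots> \<le> norm (a j) * norm (y - x)" by (rule Cauchy_Schwarz_ineq2)
    also have "\<dots> \<le> D * norm (y - x)" using D by (intro mult_right_mono) auto
    finally show "\<bar>b j - a j \<bullet> y - (b j - a j \<bullet> x)\<bar> \<le> D * norm (y - x)" .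
    show "\<bar>b j - a j \<bullet> y - (b j - a j \<bullet> x) - - a j \<bullet> (y - x)\<bar> \<le> D * (norm (y - x))\<^sup>2"
      using D by (simp add: inner_diff_right)
  qed
  from quadratic_approx_mult[OF this G(2) D(1) G(1)] insert.hyps
  show ?case using D(1) G(1)
    by (intro exI[of _ "\<lambda>x. (b j - a j \<bullet> x) *\<^sub>R G x + (\<Prod>i\<in>A. b i - a i \<bullet> x) *\<^sub>R - a j"]
          exI[of _ "3 * D * C"]) simp
qed

section \<open>Slowly decaying sequences and divergent sums\<close>

text \<open>The reciprocal of \<open>w k\<close> grows by at most 1 per step, so \<open>w k\<close>
  dominates a shifted harmonic sequence.\<close>

lemma not_summable_of_slow_decay:
  fixes w :: "nat \<Rightarrow> real"
  assumes pos: "\<And>k. 0 < w k" and le1: "\<And>k. w k \<le> 1"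
    and step: "\<And>k. w (Suc k) \<ge> w k - (w k)\<^sup>2 / 2"
  shows "\<not> summable w"
proof
  assume sw: "summable w"
  obtain N :: nat where N: "1 / w 0 \<le> real N" using real_arch_simple by blast
  have inv: "1 / w k \<le> real (k + N)" for k
  proof (induction k)
    case 0 show ?case using N by simp
  next
    case (Suc k)
    let ?u = "w k"
    have u: "0 < ?u" "?u \<le> 1" using pos le1 by auto
    have "?u * ?u \<le> 1 * ?u" using u by (intro mult_right_mono) auto
    then have "0 \<le> ?u * (?u - ?u * ?u) / 2" using u by simp
    \<comment> \<open>The product exceeds \<open>?u\<close> by
      \<open>?u * (?u - ?u * ?u) / 2\<close>; the coefficient 1/2 in \<open>step\<close> leaves this
      room.\<close>
    then have "?u \<le> (?u - ?u\<^sup>2 / 2) * (1 + ?u)" by (simp add: algebra_simps power2_eq_square)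
    also have "\<dots> \<le> w (Suc k) * (1 + ?u)" using step[of k] u by (intro mult_right_mono) auto
    finally have "1 / w (Suc k) \<le> (1 + ?u) / ?u"
      using pos[of "Suc k"] u by (simp add: field_simps)
    also have "\<dots> = 1 / ?u + 1" using u by (simp add: field_simps)
    finally show ?case using Suc by simp
  qed
  have "summable (\<lambda>k. inverse (real (k + N)))"
  proof (rule summable_comparison_test'[OF sw])
    fix k
    have "0 < 1 / w k" using pos by simp
    then have "0 < real (k + N)" using inv[of k] by linarith
    then show "norm (inverse (real (k + N))) \<le> w k"
      using inv[of k] pos[of k] by (simp add: field_simps)
  qed
  then have "summable (\<lambda>k. inverse (real k))" by (rule summable_iff_shift[THEN iffD1])
  then show False using not_summable_harmonic[where 'a=real] by simp
qed

lemma filterlim_sum_at_top: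
  fixes t :: "nat \<Rightarrow> real"
  assumes "\<And>k. 0 \<le> t k" "\<not> summable t"
  shows "filterlim (\<lambda>n. \<Sum>k<n. t k) at_top sequentially"
proof -
  have "\<exists>n. Z < (\<Sum>k<n. t k)" for Z
    using assms bounded_imp_summable[of t Z] lessThan_Suc_atMost
    by (metis not_le)
  moreover have "(\<Sum>k<n. t k) \<le> (\<Sum>k<m. t k)" if "n \<le> m" for n m
    using that assms by (intro sum_mono2) auto
  ultimately show ?thesis unfolding filterlim_at_top eventually_sequentially
    by (meson less_imp_le order_trans)
qed

section \<open>Active constraints and the barrier function\<close>

definition active :: "'i set \<Rightarrow> ('i \<Rightarrow> 'a::real_inner) \<Rightarrow> ('i \<Rightarrow> real) \<Rightarrow> 'a \<Rightarrow> 'i set" where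
  "active I a b x = {i\<in>I. a i \<bullet> x = b i}"

text \<open>Collects what the scheduler needs to know about \<open>w\<close>, so that its product
  formula stays inside \<open>barrier_exists\<close>. The last inequality is the recurrence of
  \<open>not_summable_of_slow_decay\<close>.\<close>

definition barrier ::
  "'i set \<Rightarrow> ('i \<Rightarrow> 'a::real_inner) \<Rightarrow> ('i \<Rightarrow> real) \<Rightarrow> 'a set \<Rightarrow> real \<Rightarrow> 'i set
   \<Rightarrow> ('a \<Rightarrow> real) \<Rightarrow> ('a \<Rightarrow> 'a) \<Rightarrow> real \<Rightarrow> bool" where
  "barrier I a b S K J w G \<delta> \<longleftrightarrow> \<delta> > 0 \<and> (\<forall>x\<in>S. active I a b x = J \<longrightarrow> 0 < w x \<and> w x \<le> 1 \<and>
    (\<forall>r. norm r \<le> K \<and> (\<forall>i\<in>J. a i \<bullet> r \<le> 0) \<longrightarrow>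
      (\<forall>s\<in>{0..\<delta> * w x}. x + s *\<^sub>R r \<in> S \<and> active I a b (x + s *\<^sub>R r) \<subseteq> J) \<and>
      (0 \<le> G x \<bullet> r \<longrightarrow> w x - (w x)\<^sup>2 / 2 \<le> w (x + (\<delta> * w x) *\<^sub>R r))))"

text \<open>Every inactive slack is at least \<open>w x\<close> and shrinks at bounded speed, so a
  move of length proportional to \<open>w x\<close> cannot exhaust it. Over such a move the
  second-order error of \<open>w\<close> is of order \<open>(w x)\<^sup>2\<close>.\<close>

lemma barrier_exists:
  fixes S :: "'a::euclidean_space set"
  assumes fin: "finite I" and S: "S = {x. \<forall>i\<in>I. a i \<bullet> x \<le> b i}" and bS: "bounded S"
    and le1: "\<And>x i. x \<in> S \<Longrightarrow> i \<in> I \<Longrightarrow> b i - a i \<bullet> x \<le> (1::real)"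
    and K: "K > 0"
  shows "\<exists>w G \<delta>. barrier I a b S K J w G \<delta>"
proof -
  define w where "w = (\<lambda>x. \<Prod>i\<in>I - J. b i - a i \<bullet> x)"
  obtain G C where C: "C \<ge> 0" and qa: "quadratic_approx S w G C"
    using quadratic_approx_prod_affine[OF finite_Diff[OF fin] bS] unfolding w_def by blast
  define D where "D = 1 + C + (\<Sum>i\<in>I. norm (a i))"
  have D: "D \<ge> 1" "C \<le> D" "norm (a i) \<le> D" if "i \<in> I" for i
    using C member_le_sum[OF that, of "\<lambda>i. norm (a i)"] fin
    unfolding D_def by (auto simp: sum_nonneg)
  have D1: "D \<ge> 1" "C \<le> D" using C unfolding D_def by (auto simp: sum_nonneg)
  \<comment> \<open>This choice makes \<open>\<delta> * D * (1 + K)\<close> equal to 1/2. Hence a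
    move uses at most half of \<open>w x\<close> of any inactive slack, and the second-order error
    is at most a quarter of the square of \<open>w x\<close>.\<close>
  define \<delta> where "\<delta> = 1 / (2 * D * (1 + K))"
  have \<delta>: "\<delta> > 0" unfolding \<delta>_def using D1 K by simp
  have \<delta>1: "\<delta> * D * (1 + K) = 1 / 2" 
  proof -
    have "D * (1 + K) \<noteq> 0" using D1 K by simp
    then show ?thesis unfolding \<delta>_def by (simp add: mult.assoc)
  qed
  show ?thesis unfolding barrier_def
  proof (intro exI[of _ w] exI[of _ G] exI[of _ \<delta>] conjI ballI impI allI)
    fix x assume x: "x \<in> S" and J: "active I a b x = J"
    have slack: "0 < b i - a i \<bullet> x" "b i - a i \<bullet> x \<le> 1" if "i \<in> I - J" for i
      using that x le1[of x i] J unfolding active_def S by (auto simp: order_le_less)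
    show w0: "0 < w x" unfolding w_def using slack by (intro prod_pos) auto
    show "w x \<le> 1" unfolding w_def using slack by (intro prod_le_1) (auto simp: less_imp_le)
    have w_le: "w x \<le> b i - a i \<bullet> x" if i: "i \<in> I - J" for i
    proof -
      have "w x = (b i - a i \<bullet> x) * (\<Prod>i\<in>I - J - {i}. b i - a i \<bullet> x)"
        unfolding w_def using fin i by (intro prod.remove) auto
      also have "\<dots> \<le> (b i - a i \<bullet> x) * 1"
        using slack i by (intro mult_left_mono prod_le_1) (auto simp: less_imp_le)
      finally show ?thesis by simp
    qed
    fix r assume r: "norm r \<le> K \<and> (\<forall>i\<in>J. a i \<bullet> r \<le> 0)"
    have strict: "a i \<bullet> (x + s *\<^sub>R r) < b i" if i: "i \<in> I - J" and s: "s \<in> {0..\<delta> * w x}" for i s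
    proof -
      have "a i \<bullet> r \<le> norm (a i) * norm r" by (rule norm_cauchy_schwarz)
      also have "\<dots> \<le> D * (1 + K)" using D(3)[of i] D1 i r by (intro mult_mono) auto
      finally have "s * (a i \<bullet> r) \<le> (\<delta> * w x) * (D * (1 + K))"
        using s D1 K \<delta> w0
        by (intro order_trans[OF mult_left_mono mult_right_mono]) auto
      also have "\<dots> = w x * (\<delta> * D * (1 + K))" by (simp add: algebra_simps)
      also have "\<dots> < b i - a i \<bullet> x" unfolding \<delta>1 using w_le[OF i] w0 by simp
      finally show ?thesis by (simp add: inner_add_right)
    qed
    have weak: "a i \<bullet> (x + s *\<^sub>R r) \<le> b i" if "i \<in> J" "s \<ge> 0" for i s
    proof -
      have "a i \<bullet> x = b i" using that(1) J unfolding active_def by auto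
      moreover have "s * (a i \<bullet> r) \<le> 0" using r that by (simp add: mult_nonneg_nonpos)
      ultimately show ?thesis by (simp add: inner_add_right)
    qed
    show xs: "x + s *\<^sub>R r \<in> S" if "s \<in> {0..\<delta> * w x}" for s
      unfolding S using strict[OF _ that] weak that less_imp_le by fastforce
    show "active I a b (x + s *\<^sub>R r) \<subseteq> J" if "s \<in> {0..\<delta> * w x}" for s
      using strict[OF _ that] unfolding active_def by fastforce
    assume Gr: "0 \<le> G x \<bullet> r"
    let ?y = "x + (\<delta> * w x) *\<^sub>R r"
    have "?y \<in> S" using xs[of "\<delta> * w x"] \<delta> w0 by simp
    then have q: "\<bar>w ?y - w x - G x \<bullet> (?y - x)\<bar> \<le> C * (norm (?y - x))\<^sup>2"
      using qa x unfolding quadratic_approx_def by blast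
    have "norm (?y - x) \<le> \<delta> * w x * (1 + K)" using \<delta> w0 r by simp
    then have "(norm (?y - x))\<^sup>2 \<le> (\<delta> * w x * (1 + K))\<^sup>2" by (intro power_mono) auto
    then have "C * (norm (?y - x))\<^sup>2 \<le> D * (\<delta> * w x * (1 + K))\<^sup>2"
      using D1 by (intro mult_mono) auto
    \<comment> \<open>The extra factor \<open>D\<close> completes the square of
      \<open>\<delta> * D * (1 + K)\<close>.\<close>
    also have "\<dots> \<le> D * D * (\<delta> * w x * (1 + K))\<^sup>2"
      using D1 by (intro mult_right_mono) auto
    also have "\<dots> = (\<delta> * D * (1 + K))\<^sup>2 * (w x)\<^sup>2" by (simp add: power2_eq_square)
    also have "\<dots> \<le> (w x)\<^sup>2 / 2" unfolding \<delta>1 by (simp add: power2_eq_square)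
    finally have "C * (norm (?y - x))\<^sup>2 \<le> (w x)\<^sup>2 / 2" .
    moreover have "0 \<le> G x \<bullet> (?y - x)" using Gr \<delta> w0 by simp
    ultimately show "w x - (w x)\<^sup>2 / 2 \<le> w ?y" using q by linarith
  qed (fact \<delta>)
qed

section \<open>Traps and the environment's strategy\<close>

text \<open>The rates depend on the mode alone, which makes the resulting strategy positional. The
  second alternative asks for equality because a negative product would deactivate a constraint of
  \<open>J\<close> and the trap would not persist.\<close>

definition trap :: "('i \<Rightarrow> 'a::real_inner) \<Rightarrow> 'm set \<Rightarrow> ('m \<Rightarrow> 'a set) \<Rightarrow> 'i set \<Rightarrow> bool" where
  "trap a M R J \<longleftrightarrow> (\<exists>v \<rho>. \<forall>m\<in>M. \<rho> m \<in> R m \<and>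
     ((\<exists>i\<in>J. a i \<bullet> \<rho> m > 0) \<or> (\<forall>i\<in>J. a i \<bullet> \<rho> m = 0) \<and> v \<bullet> \<rho> m < 0))"

lemma hist_last_play_Suc:
  "hist_last (play \<sigma> \<pi> x0 (Suc k)) = hist_last (play \<sigma> \<pi> x0 k)
     + snd (\<sigma> (play \<sigma> \<pi> x0 k)) *\<^sub>R \<pi> (play \<sigma> \<pi> x0 k) (\<sigma> (play \<sigma> \<pi> x0 k))"
  by (simp add: Let_def hist_last_def)

lemma hist_last_Nil [simp]: "hist_last (x0, []) = x0"
  by (simp add: hist_last_def)

lemma trap_env_wins:
  fixes M :: "'m set" and R :: "'m \<Rightarrow> (real^'n) set"
  assumes finM: "finite M" and M: "M \<noteq> {}" and S: "S = {x. \<forall>i\<in>I. a i \<bullet> x \<le> b i}" and bS: "bounded S"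
    and tr: "trap a M R J" and J: "J \<subseteq> active I a b x0"
  shows "\<exists>\<pi>. env_positional \<pi> \<and> env_wins M R S x0 \<pi>"
proof -
  obtain v \<rho> where \<rho>: "\<And>m. m \<in> M \<Longrightarrow> \<rho> m \<in> R m"
    and dich: "\<And>m. m \<in> M \<Longrightarrow> (\<exists>i\<in>J. a i \<bullet> \<rho> m > 0) \<or> (\<forall>i\<in>J. a i \<bullet> \<rho> m = 0) \<and> v \<bullet> \<rho> m < 0"
    using tr unfolding trap_def by blast
  define \<pi> :: "('m,'n) hist \<Rightarrow> 'm \<times> real \<Rightarrow> real^'n" where "\<pi> = (\<lambda>h mv. \<rho> (fst mv))"
  \<comment> \<open>The slowest descent of \<open>v\<close> among the finitely many descending
    modes; the element 1 keeps the set nonempty if there are none.\<close>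
  define d where "d = Min ((\<lambda>m. \<bar>v \<bullet> \<rho> m\<bar>) ` {m\<in>M. v \<bullet> \<rho> m < 0} \<union> {1})"
  have d: "d > 0" "\<And>m. m \<in> M \<Longrightarrow> v \<bullet> \<rho> m < 0 \<Longrightarrow> v \<bullet> \<rho> m \<le> - d"
  proof -
    show "d > 0" unfolding d_def using finM by (subst Min_gr_iff) auto
    fix m assume m: "m \<in> M" "v \<bullet> \<rho> m < 0"
    then have "d \<le> \<bar>v \<bullet> \<rho> m\<bar>" unfolding d_def using finM by (intro Min_le) auto
    then show "v \<bullet> \<rho> m \<le> - d" using m by simp
  qed
  have "\<not> safe_nonzeno S \<sigma> \<pi> x0" if \<sigma>: "sched_strategy M \<sigma>" for \<sigma>
  proof
    assume sn: "safe_nonzeno S \<sigma> \<pi> x0"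
    define X where "X = (\<lambda>k. hist_last (play \<sigma> \<pi> x0 k))"
    define m where "m = (\<lambda>k. fst (\<sigma> (play \<sigma> \<pi> x0 k)))"
    define t where "t = (\<lambda>k. snd (\<sigma> (play \<sigma> \<pi> x0 k)))"
    have X0: "X 0 = x0" unfolding X_def by simp
    have XS: "X (Suc k) = X k + t k *\<^sub>R \<rho> (m k)" for k
      unfolding X_def t_def m_def hist_last_play_Suc by (simp add: \<pi>_def)
    have m: "m k \<in> M" and t: "t k > 0" for k
      using \<sigma> unfolding m_def t_def sched_strategy_def by blast+
    have inS: "X k \<in> S" for k using sn unfolding safe_nonzeno_def X_def Let_def by blast
    have T: "filterlim (\<lambda>k. \<Sum>i<k. t i) at_top sequentially"
      using sn unfolding safe_nonzeno_def t_def by blast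
    \<comment> \<open>On a safe run no rate can violate \<open>J\<close>, since any positive
      duration would overshoot an active constraint. So only the descending alternative occurs, and
      it keeps \<open>J\<close> active.\<close>
    have inv: "J \<subseteq> active I a b (X k) \<and> v \<bullet> X k \<le> v \<bullet> x0 - d * (\<Sum>i<k. t i)" for k
    proof (induction k)
      case 0 then show ?case using J X0 by simp
    next
      case (Suc k)
      have "\<not> a i \<bullet> \<rho> (m k) > 0" if "i \<in> J" for i
      proof
        assume "a i \<bullet> \<rho> (m k) > 0"
        then have "t k * (a i \<bullet> \<rho> (m k)) > 0" using t by simp
        moreover have "a i \<bullet> X k = b i" "a i \<bullet> X (Suc k) \<le> b i"
          using Suc that inS[of "Suc k"] unfolding active_def S by auto
        ultimately show False unfolding XS by (simp add: inner_add_right)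
      qed
      then have z: "\<forall>i\<in>J. a i \<bullet> \<rho> (m k) = 0" and "v \<bullet> \<rho> (m k) < 0" using dich[OF m] by blast+
      then have "v \<bullet> \<rho> (m k) \<le> - d" using d m by blast
      then have "t k * (v \<bullet> \<rho> (m k)) \<le> t k * - d" using t[of k] by (intro mult_left_mono) auto
      moreover have "J \<subseteq> active I a b (X (Suc k))"
        using Suc z unfolding XS active_def by (auto simp: inner_add_right)
      ultimately show ?case using Suc unfolding XS by (simp add: inner_add_right algebra_simps)
    qed
    obtain B where B: "\<And>x. x \<in> S \<Longrightarrow> norm x \<le> B" using bS unfolding bounded_iff by blast
    \<comment> \<open>By this time \<open>v \<bullet> X k\<close> would lie below its lower bound
      \<open>- norm v * B\<close> on \<open>S\<close>.\<close>
    obtain k where k: "(v \<bullet> x0 + norm v * B + 1) / d \<le> (\<Sum>i<k. t i)"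
      using T unfolding filterlim_at_top eventually_sequentially by blast
    have "- (v \<bullet> X k) \<le> norm v * norm (X k)"
      using Cauchy_Schwarz_ineq2[of v "X k"] by linarith
    also have "\<dots> \<le> norm v * B" using B[OF inS] by (intro mult_left_mono) auto
    finally show False using inv[of k] k d(1) by (simp add: field_simps)
  qed
  then have "env_wins M R S x0 \<pi>"
    unfolding env_wins_def env_strategy_def using \<rho> by (auto simp: \<pi>_def)
  moreover have "env_positional \<pi>" unfolding env_positional_def \<pi>_def by simp
  ultimately show ?thesis by blast
qed

section \<open>The scheduler's strategy\<close>

text \<open>All subsets of the initial active set must be trap-free because the environment may
  deactivate constraints and thereby choose which subset becomes relevant.\<close>

lemma no_trap_sched_wins:
  fixes M :: "'m set" and R :: "'m \<Rightarrow> (real^'n) set" and S :: "(real^'n) set"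
  assumes M: "M \<noteq> {}" and fin: "finite I" and S: "S = {x. \<forall>i\<in>I. a i \<bullet> x \<le> b i}" and bS: "bounded S"
    and le1: "\<And>x i. x \<in> S \<Longrightarrow> i \<in> I \<Longrightarrow> b i - a i \<bullet> x \<le> (1::real)"
    and K: "K > 0" "\<And>m r. m \<in> M \<Longrightarrow> r \<in> R m \<Longrightarrow> norm r \<le> K"
    and x0: "x0 \<in> S" and nt: "\<And>J. J \<subseteq> active I a b x0 \<Longrightarrow> \<not> trap a M R J"
  shows "\<exists>\<sigma>. sched_positional \<sigma> \<and> sched_wins M R S x0 \<sigma>"
proof -
  let ?act = "active I a b"
  obtain w G \<delta> where bar: "\<And>J. barrier I a b S K J (w J) (G J) (\<delta> J)"
    using barrier_exists[OF fin S bS le1 K(1)] by metis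
  have \<delta>: "\<delta> J > 0" for J using bar unfolding barrier_def by blast
  have w: "0 < w (?act x) x \<and> w (?act x) x \<le> 1" if "x \<in> S" for x
    using bar[of "?act x"] that unfolding barrier_def by simp
  have safe: "x + s *\<^sub>R r \<in> S \<and> ?act (x + s *\<^sub>R r) \<subseteq> ?act x"
    if "x \<in> S" "norm r \<le> K" "\<forall>i\<in>?act x. a i \<bullet> r \<le> 0" "s \<in> {0..\<delta> (?act x) * w (?act x) x}" for x r s
    using bar[of "?act x"] that unfolding barrier_def by simp
  have decay: "w (?act x) x - (w (?act x) x)\<^sup>2 / 2 \<le> w (?act x) (x + (\<delta> (?act x) * w (?act x) x) *\<^sub>R r)"
    if "x \<in> S" "norm r \<le> K" "\<forall>i\<in>?act x. a i \<bullet> r \<le> 0" "0 \<le> G (?act x) x \<bullet> r" for x r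
    using bar[of "?act x"] that unfolding barrier_def by simp
  \<comment> \<open>If no mode is good at \<open>x\<close>, the offending rates form a trap with
    direction \<open>G (?act x) x\<close>. The gradient condition concerns only rates tangent to all
    active constraints; any other allowed rate deactivates one, which can happen only finitely
    often.\<close>
  define good where "good = (\<lambda>x m. m \<in> M \<and> (\<forall>r\<in>R m. (\<forall>i\<in>?act x. a i \<bullet> r \<le> 0) \<and>
     ((\<forall>i\<in>?act x. a i \<bullet> r = 0) \<longrightarrow> 0 \<le> G (?act x) x \<bullet> r)))"
  have ex_good: "\<exists>m. good x m" if "?act x \<subseteq> ?act x0" for x
  proof (rule ccontr)
    assume "\<nexists>m. good x m"
    then have "\<forall>m\<in>M. \<exists>r. r \<in> R m \<and> ((\<exists>i\<in>?act x. a i \<bullet> r > 0) \<or>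
        (\<forall>i\<in>?act x. a i \<bullet> r = 0) \<and> G (?act x) x \<bullet> r < 0)"
      unfolding good_def by (meson not_le)
    then have "trap a M R (?act x)" unfolding trap_def by (metis bchoice)
    then show False using nt[OF that] by blast
  qed
  \<comment> \<open>The defaults here and in \<open>time\<close> keep the strategy legal at every
    history, including those the play never reaches.\<close>
  define mode where "mode = (\<lambda>x. if \<exists>m. good x m then SOME m. good x m else SOME m. m \<in> M)"
  define time where "time = (\<lambda>x. if x \<in> S then \<delta> (?act x) * w (?act x) x else 1)"
  define \<sigma> :: "('m,'n) hist \<Rightarrow> 'm \<times> real" where "\<sigma> = (\<lambda>h. (mode (hist_last h), time (hist_last h)))"
  have good: "good x (mode x)" if "?act x \<subseteq> ?act x0" for x
    using ex_good[OF that] unfolding mode_def by (simp add: someI_ex)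
  have modeM: "mode x \<in> M" for x
  proof (cases "\<exists>m. good x m")
    case True
    then have "good x (mode x)" unfolding mode_def by (simp add: someI_ex)
    then show ?thesis unfolding good_def by blast
  next
    case False
    then show ?thesis using M unfolding mode_def by (metis some_in_eq)
  qed
  have time: "time x > 0" for x using \<delta> w unfolding time_def by auto
  have "safe_nonzeno S \<sigma> \<pi> x0" if \<pi>: "env_strategy M R \<pi>" for \<pi>
  proof -
    define X where "X = (\<lambda>k. hist_last (play \<sigma> \<pi> x0 k))"
    define r where "r = (\<lambda>k. \<pi> (play \<sigma> \<pi> x0 k) (\<sigma> (play \<sigma> \<pi> x0 k)))"
    have X0: "X 0 = x0" unfolding X_def by simp
    have XS: "X (Suc k) = X k + time (X k) *\<^sub>R r k" for k
      unfolding X_def r_def hist_last_play_Suc by (simp add: \<sigma>_def)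
    have r: "r k \<in> R (mode (X k))" for k
      using \<pi> modeM time unfolding env_strategy_def r_def X_def \<sigma>_def by blast
    have rK: "norm (r k) \<le> K" for k using K(2)[OF modeM r] .
    have inv: "X k \<in> S \<and> ?act (X k) \<subseteq> ?act x0" for k
    proof (induction k)
      case 0 then show ?case using X0 x0 by simp
    next
      case (Suc k)
      then have "\<forall>i\<in>?act (X k). a i \<bullet> r k \<le> 0" using good r unfolding good_def by blast
      from safe[OF _ rK this, of "time (X k)"] time[of "X k"] Suc show ?case
        unfolding XS by (auto simp: time_def)
    qed
    have nonpos: "\<forall>i\<in>?act (X k). a i \<bullet> r k \<le> 0" for k
      using inv good r unfolding good_def by blast
    have seg: "X k + s *\<^sub>R r k \<in> S \<and> ?act (X k + s *\<^sub>R r k) \<subseteq> ?act (X k)" if "s \<in> {0..time (X k)}" for k s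
      using safe[OF _ rK nonpos, of k s] inv that by (simp add: time_def)
    have anti: "?act (X (Suc k)) \<subseteq> ?act (X k)" for k
      unfolding XS using seg[of "time (X k)" k] time[of "X k"] by simp
    obtain k0 where k0: "\<And>k. k \<ge> k0 \<Longrightarrow> ?act (X k) = ?act (X k0)"
    proof -
      \<comment> \<open>Later active sets are subsets of the one at \<open>k0\<close> with no
        smaller cardinality, hence equal to it.\<close>
      obtain k0 where min: "\<And>k. card (?act (X k0)) \<le> card (?act (X k))"
        using ex_has_least_nat[of "\<lambda>_. True" _ "\<lambda>k. card (?act (X k))"] by blast
      have "?act (X k) = ?act (X k0)" if "k \<ge> k0" for k
      proof (rule card_subset_eq)
        show "finite (?act (X k0))" using fin unfolding active_def by simp
        show sub: "?act (X k) \<subseteq> ?act (X k0)" using lift_Suc_antimono_le[of "\<lambda>k. ?act (X k)", OF anti that] .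
        show "card (?act (X k)) = card (?act (X k0))"
          using card_mono[OF \<open>finite (?act (X k0))\<close> sub] min by (simp add: le_antisym)
      qed
      then show thesis using that by blast
    qed
    let ?J = "?act (X k0)"
    \<comment> \<open>The barrier depends on the active set, so values at successive states are
      comparable only after that set has become constant.\<close>
    define u where "u = (\<lambda>k. w ?J (X (k + k0)))"
    have actJ: "?act (X (k + k0)) = ?J" for k by (rule k0) simp
    have "\<not> summable u"
    proof (rule not_summable_of_slow_decay)
      fix k
      let ?x = "X (k + k0)"
      show "0 < u k" "u k \<le> 1" using w[of ?x] inv actJ[of k] unfolding u_def by auto
      \<comment> \<open>A constraint active at both ends of a move of positive length forces a
        tangent rate, which triggers the gradient clause of \<open>good\<close>.\<close>
      have "a i \<bullet> r (k + k0) = 0" if i: "i \<in> ?J" for i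
      proof -
        have "a i \<bullet> ?x = b i" "a i \<bullet> X (Suc (k + k0)) = b i"
          using i actJ[of k] actJ[of "Suc k"] unfolding active_def by auto
        then have "time ?x * (a i \<bullet> r (k + k0)) = 0" unfolding XS by (simp add: inner_add_right)
        then show ?thesis using time[of ?x] by simp
      qed
      then have "0 \<le> G (?act ?x) ?x \<bullet> r (k + k0)"
        using good[of ?x] inv r[of "k + k0"] actJ[of k] unfolding good_def by auto
      from decay[OF _ rK nonpos this] inv[of "k + k0"] actJ[of k]
      show "u k - (u k)\<^sup>2 / 2 \<le> u (Suc k)" unfolding u_def by (simp add: XS time_def)
    qed
    then have "\<not> summable (\<lambda>k. time (X (k + k0)))"
      using inv actJ \<delta>[of ?J] unfolding u_def time_def by (simp add: summable_cmult_iff)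
    then have "\<not> summable (\<lambda>k. time (X k))"
      by (simp only: summable_iff_shift[of "\<lambda>k. time (X k)" k0] not_False_eq_True simp_thms)
    then have "filterlim (\<lambda>n. \<Sum>k<n. time (X k)) at_top sequentially"
      using time less_imp_le by (intro filterlim_sum_at_top) blast
    moreover have "snd (\<sigma> (play \<sigma> \<pi> x0 k)) = time (X k)" for k unfolding \<sigma>_def X_def by simp
    ultimately show ?thesis unfolding safe_nonzeno_def Let_def
      using inv seg unfolding X_def r_def by auto
  qed
  then have "sched_wins M R S x0 \<sigma>"
    unfolding sched_wins_def sched_strategy_def using modeM time by (auto simp: \<sigma>_def)
  moreover have "sched_positional \<sigma>" unfolding sched_positional_def \<sigma>_def by simp
  ultimately show ?thesis by blast
qed

section \<open>Positional determinacy\<close>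

theorem theorem1:
  fixes M :: "'m set" and R :: "'m \<Rightarrow> (real^'n) set" and S :: "(real^'n) set"
    and x0 :: "real^'n"
  assumes "is_BMS M R" and "polytope S" and "x0 \<in> S"
  shows "(\<exists>\<sigma>. sched_wins M R S x0 \<sigma>) \<noteq> (\<exists>\<pi>. env_wins M R S x0 \<pi>)
    \<and> ((\<exists>\<sigma>. sched_wins M R S x0 \<sigma>) \<longrightarrow> (\<exists>\<sigma>. sched_positional \<sigma> \<and> sched_wins M R S x0 \<sigma>))
    \<and> ((\<exists>\<pi>. env_wins M R S x0 \<pi>) \<longrightarrow> (\<exists>\<pi>. env_positional \<pi> \<and> env_wins M R S x0 \<pi>))"
proof -
  have M: "finite M" "M \<noteq> {}" and R: "\<And>m. m \<in> M \<Longrightarrow> polytope (R m)"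
    using assms(1) unfolding is_BMS_def by auto
  obtain I :: "(real^'n) set set" and a b where I: "finite I" "S = {x. \<forall>i\<in>I. a i \<bullet> x \<le> b i}"
    "\<And>x i. x \<in> S \<Longrightarrow> i \<in> I \<Longrightarrow> b i - a i \<bullet> x \<le> 1"
    using polytope_normalized_halfspaces[OF assms(2)] by blast
  have bS: "bounded S" using assms(2) by (rule polytope_imp_bounded)
  have "bounded (\<Union>m\<in>M. R m)" using M R polytope_imp_bounded by blast
  then obtain K where K: "K > 0" "\<And>m r. m \<in> M \<Longrightarrow> r \<in> R m \<Longrightarrow> norm r \<le> K"
    unfolding bounded_pos by blast
  \<comment> \<open>One player always has a positional win. Since both cannot win, any winner is
    that player, which gives determinacy and positionality together.\<close>
  have "(\<exists>\<pi>. env_positional \<pi> \<and> env_wins M R S x0 \<pi>) \<or>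
      (\<exists>\<sigma>. sched_positional \<sigma> \<and> sched_wins M R S x0 \<sigma>)"
  proof (cases "\<exists>J\<subseteq>active I a b x0. trap a M R J")
    case True
    then obtain J where J: "J \<subseteq> active I a b x0" "trap a M R J" by blast
    from trap_env_wins[OF M I(2) bS J(2,1)] show ?thesis ..
  next
    case False
    then have nt: "\<not> trap a M R J" if "J \<subseteq> active I a b x0" for J using that by blast
    from no_trap_sched_wins[OF M(2) I(1,2) bS I(3) K assms(3) nt] show ?thesis ..
  qed
  \<comment> \<open>Two winning strategies played against each other would produce contradictory
    verdicts on one run.\<close>
  moreover have "\<not> ((\<exists>\<sigma>. sched_wins M R S x0 \<sigma>) \<and> (\<exists>\<pi>. env_wins M R S x0 \<pi>))"
    unfolding sched_wins_def env_wins_def by blast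
  ultimately show ?thesis by blast
qed

end
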